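(* Let $(\phi(\tau),\ \tau\in\mathcal{T}_0^p)$ be an admissible family, with value family $V_p$ and strict value family $V_p^+$. Then: 1. The admissible families $(V_p(\tau),\ \tau\in\mathcal{T}_0^p)$ and $(V_p^+(\tau),\ \tau\in\mathcal{T}_{0^+}^p)$ are predictable supermartingale systems. 2. $V_p$ is the predictable Snell envelope system associated with $(\phi(S),\ S\in\mathcal{T}_0^p)$, that is, the smallest predictable supermartingale system which is greater (a.s.) than $\phi$: one has $V_p(S)\ge\phi(S)$ a.s. for all $S\in\mathcal{T}_0^p$, and if $(V'(\tau),\ \tau\in\mathcal{T}_0^p)$ is any predictable supermartingale system with $V'(\tau)\ge\phi(\tau)$ a.s. for all $\tau\in\mathcal{T}_0^p$, then $V_p(S)\le V'(S)$ a.s. for all $S\in\mathcal{T}_0^p$.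
   Context: Fix $T\in(0,\infty)$ and a filtered probability space $(\Omega,\mathbb{F}=(\mathcal{F}_t)_{t\in[0,T]},P)$ whose filtration satisfies the usual conditions (right-continuity and completeness) and is not quasi-left-continuous; $\mathcal{F}_0$ contains only sets of probability $0$ or $1$. For a stopping time $S$, $\mathcal{F}_{S^-}$ is the usual $\sigma$-field of events strictly before $S$ (with $\mathcal{F}_{0^-}=\mathcal{F}_0$). $\mathcal{T}_0^p$ is the set of predictable stopping times with values in $[0,T]$. For $S\in\mathcal{T}_0^p$, $\mathcal{T}_S^p$ is the set of $\tau\in\mathcal{T}_0^p$ with $\tau\ge S$ a.s., and $\mathcal{T}_{S^+}^p$ is the set of $\tau\in\mathcal{T}_0^p$ with $\tau>S$ a.s. on $\{S<T\}$ and $\tau=T$ a.s. on $\{S=T\}$; in particular $\mathcal{T}_{0^+}^p$ is the set of $\tau\in\mathcal{T}_0^p$ with $\tau>0$ a.s. An admissible family is a family $(\phi(\tau),\ \tau\in\mathcal{T}_0^p)$ such that (1) each $\phi(\tau)$ is an $\mathcal{F}_{\tau^-}$-measurable $[0,\infty]$-valued random variable; (2) for all $\tau,\tau'\in\mathcal{T}_0^p$, $\phi(\tau)=\phi(\tau')$ a.s. on $\{\tau=\tau'\}$. For $S\in\mathcal{T}_0^p$ put $V_p(S):=\operatorname{ess\,sup}_{\tau\in\mathcal{T}_S^p}E[\phi(\tau)|\mathcal{F}_{S^-}]$ and $V_p^+(S):=\operatorname{ess\,sup}_{\tau\in\mathcal{T}_{S^+}^p}E[\phi(\tau)|\mathcal{F}_{S^-}]$.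 An admissible family $U$ is a predictable supermartingale system if $E[U(\tau')|\mathcal{F}_{\tau^-}]\le U(\tau)$ a.s. for all $\tau,\tau'$ in its index set with $\tau'\ge\tau$ a.s. (the index set is $\mathcal{T}_0^p$, or $\mathcal{T}_{0^+}^p$ when the family is indexed by the latter). *)

theory Defs
  imports "HOL-Probability.Probability"
begin

text \<open>
  Time is the interval from 0 to T, but a filtration is a function on all reals, so that the
  library notions \<open>filtration\<close>, \<open>stopping_time\<close> and \<open>pre_sigma\<close> apply. A filtration on
  the interval extends to the reals by freezing it outside, and the values outside never matter:
  for a time \<open>\<tau>\<close> with values between 0 and T, the event \<open>\<tau> \<le> t\<close> is empty for
  \<open>t < 0\<close> and is the whole space for \<open>t \<ge> T\<close>.
\<close>

definition predictable_sigma ::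
    "'a measure \<Rightarrow> (real \<Rightarrow> 'a measure) \<Rightarrow> real \<Rightarrow> ('a \<times> real) measure" where
  "predictable_sigma M F T = sigma (space M \<times> {0..T})
     ({A \<times> {0} | A. A \<in> sets (F 0)} \<union>
      {A \<times> {s<..t} | A s t. 0 \<le> s \<and> s < t \<and> t \<le> T \<and> A \<in> sets (F s)})"

text \<open>
  A stopping time \<open>\<tau>\<close> is predictable if the stochastic interval from \<open>\<tau>\<close> (included) on is
  a predictable set. As rectangles over the time 0 with base in \<open>F 0\<close> are predictable,
  \<open>\<tau> = 0\<close> is a predictable time.
\<close>

definition pred_times ::
    "'a measure \<Rightarrow> (real \<Rightarrow> 'a measure) \<Rightarrow> real \<Rightarrow> ('a \<Rightarrow> real) set" where
  "pred_times M F T =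
     {\<tau>. stopping_time F \<tau> \<and> (\<forall>\<omega>\<in>space M. \<tau> \<omega> \<in> {0..T}) \<and>
         {(\<omega>, t). \<omega> \<in> space M \<and> t \<in> {0..T} \<and> \<tau> \<omega> \<le> t} \<in> sets (predictable_sigma M F T)}"

definition pred_times_from ::
    "'a measure \<Rightarrow> (real \<Rightarrow> 'a measure) \<Rightarrow> real \<Rightarrow> ('a \<Rightarrow> real) \<Rightarrow> ('a \<Rightarrow> real) set" where
  "pred_times_from M F T S = {\<tau> \<in> pred_times M F T. AE \<omega> in M. S \<omega> \<le> \<tau> \<omega>}"

definition pred_times_after ::
    "'a measure \<Rightarrow> (real \<Rightarrow> 'a measure) \<Rightarrow> real \<Rightarrow> ('a \<Rightarrow> real) \<Rightarrow> ('a \<Rightarrow> real) set" where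
  "pred_times_after M F T S =
     {\<tau> \<in> pred_times M F T.
        (AE \<omega> in M. S \<omega> < T \<longrightarrow> S \<omega> < \<tau> \<omega>) \<and> (AE \<omega> in M. S \<omega> = T \<longrightarrow> \<tau> \<omega> = T)}"

text \<open>The events strictly before \<open>S\<close>; for \<open>S = 0\<close> this is \<open>F 0\<close>.\<close>

definition strict_pre_sigma ::
    "'a measure \<Rightarrow> (real \<Rightarrow> 'a measure) \<Rightarrow> real \<Rightarrow> ('a \<Rightarrow> real) \<Rightarrow> 'a measure" where
  "strict_pre_sigma M F T S = sigma (space M)
     (sets (F 0) \<union> {A \<inter> {\<omega> \<in> space M. t < S \<omega>} | A t. t \<in> {0..T} \<and> A \<in> sets (F t)})"

definition quasi_left_continuous ::
    "'a measure \<Rightarrow> (real \<Rightarrow> 'a measure) \<Rightarrow> real \<Rightarrow> bool" where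
  "quasi_left_continuous M F T \<longleftrightarrow>
     (\<forall>\<tau>\<in>pred_times M F T.
        sets (filtration.pre_sigma (space M) F \<tau>) = sets (strict_pre_sigma M F T \<tau>))"

locale predictable_setup =
  prob_space M + complete_measure M + filtration "space M" F
  for M :: "'a measure" and F :: "real \<Rightarrow> 'a measure" +
  fixes T :: real
  assumes horizon_pos: "0 < T"
    and subalgebra_F: "\<And>t. t \<in> {0..T} \<Longrightarrow> subalgebra M (F t)"
    and right_continuous: "\<And>t. t \<in> {0..<T} \<Longrightarrow> sets (F t) = (\<Inter>s\<in>{t<..T}. sets (F s))"
    and null_sets_F: "null_sets M \<subseteq> sets (F 0)"
    and trivial_F0: "\<And>A. A \<in> sets (F 0) \<Longrightarrow> prob A = 0 \<or> prob A = 1"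
    and not_quasi_left_continuous: "\<not> quasi_left_continuous M F T"

text \<open>
  Essential supremum of a possibly uncountable family of random variables (the library's
  \<open>esssup\<close> is that of a single function). It is determined up to null sets only; as for
  conditional expectations, some version is chosen.
\<close>

definition is_ess_sup :: "'a measure \<Rightarrow> ('a \<Rightarrow> ennreal) set \<Rightarrow> ('a \<Rightarrow> ennreal) \<Rightarrow> bool" where
  "is_ess_sup M \<X> Y \<longleftrightarrow>
     Y \<in> borel_measurable M \<and> (\<forall>X\<in>\<X>. AE \<omega> in M. X \<omega> \<le> Y \<omega>) \<and>
     (\<forall>Z\<in>borel_measurable M. (\<forall>X\<in>\<X>. AE \<omega> in M. X \<omega> \<le> Z \<omega>) \<longrightarrow> (AE \<omega> in M. Y \<omega> \<le> Z \<omega>))"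

definition ess_sup :: "'a measure \<Rightarrow> ('a \<Rightarrow> ennreal) set \<Rightarrow> 'a \<Rightarrow> ennreal" where
  "ess_sup M \<X> = (SOME Y. is_ess_sup M \<X> Y)"

text \<open>A family indexed by a set \<open>I\<close> of times is a function of which only the values on \<open>I\<close> matter.\<close>

definition admissible_family ::
    "'a measure \<Rightarrow> (real \<Rightarrow> 'a measure) \<Rightarrow> real \<Rightarrow> ('a \<Rightarrow> real) set \<Rightarrow>
     (('a \<Rightarrow> real) \<Rightarrow> 'a \<Rightarrow> ennreal) \<Rightarrow> bool" where
  "admissible_family M F T I \<phi> \<longleftrightarrow>
     (\<forall>\<tau>\<in>I. \<phi> \<tau> \<in> borel_measurable (strict_pre_sigma M F T \<tau>)) \<and>
     (\<forall>\<tau>\<in>I. \<forall>\<tau>'\<in>I. AE \<omega> in M. \<tau> \<omega> = \<tau>' \<omega> \<longrightarrow> \<phi> \<tau> \<omega> = \<phi> \<tau>' \<omega>)"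

definition pred_supermartingale_system ::
    "'a measure \<Rightarrow> (real \<Rightarrow> 'a measure) \<Rightarrow> real \<Rightarrow> ('a \<Rightarrow> real) set \<Rightarrow>
     (('a \<Rightarrow> real) \<Rightarrow> 'a \<Rightarrow> ennreal) \<Rightarrow> bool" where
  "pred_supermartingale_system M F T I U \<longleftrightarrow>
     admissible_family M F T I U \<and>
     (\<forall>\<tau>\<in>I. \<forall>\<tau>'\<in>I. (AE \<omega> in M. \<tau> \<omega> \<le> \<tau>' \<omega>) \<longrightarrow>
        (AE \<omega> in M. nn_cond_exp M (strict_pre_sigma M F T \<tau>) (U \<tau>') \<omega> \<le> U \<tau> \<omega>))"

definition value_family ::
    "'a measure \<Rightarrow> (real \<Rightarrow> 'a measure) \<Rightarrow> real \<Rightarrow> (('a \<Rightarrow> real) \<Rightarrow> 'a \<Rightarrow> ennreal) \<Rightarrow>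
     ('a \<Rightarrow> real) \<Rightarrow> 'a \<Rightarrow> ennreal" where
  "value_family M F T \<phi> S =
     ess_sup M {nn_cond_exp M (strict_pre_sigma M F T S) (\<phi> \<tau>) | \<tau>. \<tau> \<in> pred_times_from M F T S}"

definition strict_value_family ::
    "'a measure \<Rightarrow> (real \<Rightarrow> 'a measure) \<Rightarrow> real \<Rightarrow> (('a \<Rightarrow> real) \<Rightarrow> 'a \<Rightarrow> ennreal) \<Rightarrow>
     ('a \<Rightarrow> real) \<Rightarrow> 'a \<Rightarrow> ennreal" where
  "strict_value_family M F T \<phi> S =
     ess_sup M {nn_cond_exp M (strict_pre_sigma M F T S) (\<phi> \<tau>) | \<tau>. \<tau> \<in> pred_times_after M F T S}"

definition is_pred_snell_envelope ::
    "'a measure \<Rightarrow> (real \<Rightarrow> 'a measure) \<Rightarrow> real \<Rightarrow> (('a \<Rightarrow> real) \<Rightarrow> 'a \<Rightarrow> ennreal) \<Rightarrow>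
     (('a \<Rightarrow> real) \<Rightarrow> 'a \<Rightarrow> ennreal) \<Rightarrow> bool" where
  "is_pred_snell_envelope M F T \<phi> V \<longleftrightarrow>
     pred_supermartingale_system M F T (pred_times M F T) V \<and>
     (\<forall>S\<in>pred_times M F T. AE \<omega> in M. \<phi> S \<omega> \<le> V S \<omega>) \<and>
     (\<forall>V'. pred_supermartingale_system M F T (pred_times M F T) V' \<longrightarrow>
        (\<forall>\<tau>\<in>pred_times M F T. AE \<omega> in M. \<phi> \<tau> \<omega> \<le> V' \<tau> \<omega>) \<longrightarrow>
        (\<forall>S\<in>pred_times M F T. AE \<omega> in M. V S \<omega> \<le> V' S \<omega>))"

end

theory Submission
  imports Defs
begin

text \<open>
  The value at \<open>S\<close> is an essential supremum of conditional rewards \<open>E[\<phi>(\<theta>) | F\<^bsub>S-\<^esub>]\<close> over the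
  times \<open>\<theta>\<close> allowed from \<open>S\<close>, and everything rests on one operation: two predictable times may be
  glued along an event known strictly before both of them, and the result is again predictable
  (\<open>pred_times_glue\<close>).

  Gluing two allowed times along the event, known strictly before \<open>S\<close>, where the first has the
  larger conditional reward attains the maximum of the two rewards. So the rewards form an upward
  directed family (\<open>rewards_directed\<close>) and the value is the limit of an increasing sequence of
  rewards (\<open>directed_ess_sup\<close>). By monotone convergence and the tower property, the conditional
  expectation at \<open>S\<close> of the value at a later \<open>S'\<close> is then the limit of rewards at \<open>S\<close> of times
  allowed from \<open>S'\<close>. These are also allowed from \<open>S\<close>, which gives the supermartingale inequality
  (\<open>val_supermartingale\<close>).

  Admissibility of the value needs a comparison of two \<open>\<sigma>\<close>-algebras: if \<open>S\<close> and \<open>S'\<close> are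
  predictable, the event \<open>S = S'\<close> is known strictly before both (\<open>eq_event_pre\<close>), the two
  \<open>\<sigma>\<close>-algebras have the same trace on it (\<open>pre_trace_eq\<close>), and so conditional expectations agree
  there (\<open>nn_cond_exp_local\<close>). Gluing a time allowed from \<open>S\<close> with the horizon off this event makes
  it allowed from \<open>S'\<close>, whence the values agree as well (\<open>val_le_on_eq\<close>).

  For the Snell envelope, \<open>S\<close> itself is allowed from \<open>S\<close>, so the value dominates \<open>\<phi>\<close>; and a
  supermartingale system above \<open>\<phi>\<close> bounds every single conditional reward, hence their essential
  supremum (\<open>val_le_supermartingale\<close>).
\<close>

section \<open>Essential suprema\<close>

lemma ennreal_inverse_antimono:
  fixes a b :: ennreal
  assumes "a \<le> b"
  shows "inverse b \<le> inverse a"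
  including ennreal.lifting
  using assms by transfer (simp add: ereal_inverse_antimono)

lemma ennreal_inverse_eq_iff: "inverse a = inverse b \<longleftrightarrow> a = (b :: ennreal)"
  including ennreal.lifting
proof (transfer, goal_cases)
  case (1 a b)
  then show ?case
    by (cases a; cases b) (auto split: if_splits)
qed

lemma ess_sup_unique:
  assumes "is_ess_sup M \<X> Y" "is_ess_sup M \<X> Z"
  shows "AE \<omega> in M. Y \<omega> = Z \<omega>"
proof -
  have "AE \<omega> in M. Y \<omega> \<le> Z \<omega>" "AE \<omega> in M. Z \<omega> \<le> Y \<omega>"
    using assms unfolding is_ess_sup_def by blast+
  then show ?thesis
    by eventually_elim simp
qed

text \<open>
  Among all countable suprema, one minimises the integral of the strictly decreasing bounded
  function \<open>inverse (1 + x)\<close> of the supremum. Adding one more member cannot decrease this integral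
  further, so that member was almost surely below already.
\<close>

lemma (in finite_measure) countable_ess_sup:
  fixes \<X> :: "('a \<Rightarrow> ennreal) set"
  assumes meas: "\<X> \<subseteq> borel_measurable M" and ne: "\<X> \<noteq> {}"
  obtains f :: "nat \<Rightarrow> 'a \<Rightarrow> ennreal"
  where "range f \<subseteq> \<X>" "is_ess_sup M \<X> (\<lambda>\<omega>. SUP n. f n \<omega>)"
proof -
  define J :: "(nat \<Rightarrow> 'a \<Rightarrow> ennreal) \<Rightarrow> ennreal"
    where "J = (\<lambda>f. \<integral>\<^sup>+ \<omega>. inverse (1 + (SUP n. f n \<omega>)) \<partial>M)"
  define \<C> where "\<C> = {f :: nat \<Rightarrow> 'a \<Rightarrow> ennreal. range f \<subseteq> \<X>}"
  have meas_f: "f n \<in> borel_measurable M" if "f \<in> \<C>" for f n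
    using that meas unfolding \<C>_def by auto
  obtain X0 where "X0 \<in> \<X>"
    using ne by auto
  then have "(\<lambda>n. X0) \<in> \<C>"
    by (auto simp: \<C>_def)
  then have "J ` \<C> \<noteq> {}"
    by auto
  from ennreal_Inf_countable_INF[OF this] obtain c :: "nat \<Rightarrow> ennreal"
    where c: "range c \<subseteq> J ` \<C>" "Inf (J ` \<C>) = (INF i. c i)"
    by auto
  have "\<exists>g\<in>\<C>. c i = J g" for i
    using c(1) by auto
  then obtain g where g: "\<And>i. g i \<in> \<C>" "\<And>i. c i = J (g i)"
    by metis
  define f where "f = (\<lambda>n. g (fst (prod_decode n)) (snd (prod_decode n)))"
  have f\<C>: "f \<in> \<C>"
    using g(1) by (auto simp: \<C>_def f_def)
  have gf: "g i j \<omega> \<le> (SUP n. f n \<omega>)" for i j \<omega>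
    by (rule SUP_upper2[of "prod_encode (i, j)"]) (auto simp: f_def)
  have "J f \<le> J (g i)" for i
    unfolding J_def
    by (intro nn_integral_mono ennreal_inverse_antimono add_left_mono SUP_least gf)
  then have Jf: "J f \<le> J h" if "h \<in> \<C>" for h
  proof -
    have "J f \<le> Inf (J ` \<C>)"
      unfolding c(2) using \<open>\<And>i. J f \<le> J (g i)\<close> g(2) by (auto intro: INF_greatest)
    also have "\<dots> \<le> J h"
      using that by (auto intro: INF_lower)
    finally show ?thesis .
  qed
  have meas_sup: "(\<lambda>\<omega>. SUP n. f n \<omega>) \<in> borel_measurable M" if "f \<in> \<C>" for f
    using meas_f[OF that] by simp
  have upper: "AE \<omega> in M. X \<omega> \<le> (SUP n. f n \<omega>)" if X: "X \<in> \<X>" for X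
  proof -
    define h where "h = case_nat X f"
    have h\<C>: "h \<in> \<C>"
      using X f\<C> by (fastforce simp: \<C>_def h_def split: nat.splits)
    have Xh: "X \<omega> \<le> (SUP n. h n \<omega>)" for \<omega>
      by (rule SUP_upper2[of 0]) (auto simp: h_def)
    have fh: "(SUP n. f n \<omega>) \<le> (SUP n. h n \<omega>)" for \<omega>
    proof (rule SUP_least)
      show "f n \<omega> \<le> (SUP n. h n \<omega>)" for n
        by (rule SUP_upper2[of "Suc n"]) (auto simp: h_def)
    qed
    have le: "inverse (1 + (SUP n. h n \<omega>)) \<le> inverse (1 + (SUP n. f n \<omega>))" for \<omega>
      by (intro ennreal_inverse_antimono add_left_mono fh)
    have "J h \<le> (\<integral>\<^sup>+ \<omega>. 1 \<partial>M)"
      unfolding J_def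
    proof (rule nn_integral_mono)
      show "inverse (1 + (SUP n. h n \<omega>)) \<le> (1 :: ennreal)" for \<omega>
        using ennreal_inverse_antimono[of 1 "1 + (SUP n. h n \<omega>)"] by simp
    qed
    also have "\<dots> < \<infinity>"
      using emeasure_finite[of "space M"] by (simp add: less_top[symmetric])
    finally have fin: "J h \<noteq> \<infinity>"
      by simp
    have "AE \<omega> in M. inverse (1 + (SUP n. f n \<omega>)) \<le> inverse (1 + (SUP n. h n \<omega>))"
    proof (rule ccontr)
      assume "\<not> ?thesis"
      then have "J h < J f"
        unfolding J_def using fin[unfolded J_def] meas_sup[OF f\<C>] meas_sup[OF h\<C>] le
        by (intro nn_integral_less) auto
      then show False
        using Jf[OF h\<C>] by simp
    qed
    then show ?thesis
    proof eventually_elim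
      case (elim \<omega>)
      then have "inverse (1 + (SUP n. f n \<omega>)) = inverse (1 + (SUP n. h n \<omega>))"
        using le[of \<omega>] by simp
      then have "1 + (SUP n. f n \<omega>) = 1 + (SUP n. h n \<omega>)"
        by (simp add: ennreal_inverse_eq_iff)
      then show ?case
        using Xh[of \<omega>] by (simp add: ennreal_add_left_cancel)
    qed
  qed
  have least: "AE \<omega> in M. (SUP n. f n \<omega>) \<le> Z \<omega>" if "\<forall>X\<in>\<X>. AE \<omega> in M. X \<omega> \<le> Z \<omega>" for Z
  proof -
    have "AE \<omega> in M. \<forall>n. f n \<omega> \<le> Z \<omega>"
      using that f\<C> unfolding \<C>_def by (subst AE_all_countable) blast
    then show ?thesis
      by eventually_elim (auto intro: SUP_least)
  qed
  show ?thesis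
  proof (rule that)
    show "range f \<subseteq> \<X>"
      using f\<C> by (simp add: \<C>_def)
    show "is_ess_sup M \<X> (\<lambda>\<omega>. SUP n. f n \<omega>)"
      unfolding is_ess_sup_def using meas_sup[OF f\<C>] upper least by blast
  qed
qed

lemma (in finite_measure) is_ess_sup_ess_sup:
  assumes "\<X> \<subseteq> borel_measurable M" "\<X> \<noteq> {}"
  shows "is_ess_sup M \<X> (ess_sup M \<X>)"
  unfolding ess_sup_def using countable_ess_sup[OF assms] by (metis someI)

text \<open>
  Directedness allows the countably many members with the right supremum to be dominated one after
  the other by an increasing sequence of members; conditional expectations commute with its limit.
\<close>

lemma (in finite_measure) directed_ess_sup:
  fixes \<X> :: "('a \<Rightarrow> ennreal) set"
  assumes meas: "\<X> \<subseteq> borel_measurable M" and ne: "\<X> \<noteq> {}"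
    and directed: "\<And>X Y. X \<in> \<X> \<Longrightarrow> Y \<in> \<X> \<Longrightarrow> \<exists>Z\<in>\<X>. AE \<omega> in M. X \<omega> \<le> Z \<omega> \<and> Y \<omega> \<le> Z \<omega>"
  obtains X :: "nat \<Rightarrow> 'a \<Rightarrow> ennreal"
  where "range X \<subseteq> \<X>" "\<And>n. AE \<omega> in M. X n \<omega> \<le> X (Suc n) \<omega>"
    "AE \<omega> in M. ess_sup M \<X> \<omega> = (SUP n. X n \<omega>)"
proof -
  obtain f :: "nat \<Rightarrow> 'a \<Rightarrow> ennreal"
    where f: "range f \<subseteq> \<X>" "is_ess_sup M \<X> (\<lambda>\<omega>. SUP n. f n \<omega>)"
    using countable_ess_sup[OF meas ne] by metis
  have "\<exists>X. \<forall>n. (X n \<in> \<X> \<and> (AE \<omega> in M. f n \<omega> \<le> X n \<omega>)) \<and> (AE \<omega> in M. X n \<omega> \<le> X (Suc n) \<omega>)"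
  proof (rule dependent_nat_choice)
    show "\<exists>Y. Y \<in> \<X> \<and> (AE \<omega> in M. f 0 \<omega> \<le> Y \<omega>)"
      using f(1) by (intro exI[of _ "f 0"]) auto
  next
    fix Y n assume "Y \<in> \<X> \<and> (AE \<omega> in M. f n \<omega> \<le> Y \<omega>)"
    then obtain Z where "Z \<in> \<X>" "AE \<omega> in M. Y \<omega> \<le> Z \<omega> \<and> f (Suc n) \<omega> \<le> Z \<omega>"
      using directed[of Y "f (Suc n)"] f(1) by auto
    then show "\<exists>Z. (Z \<in> \<X> \<and> (AE \<omega> in M. f (Suc n) \<omega> \<le> Z \<omega>)) \<and> (AE \<omega> in M. Y \<omega> \<le> Z \<omega>)"
      by auto
  qed
  then obtain X where X: "\<And>n. X n \<in> \<X>" "\<And>n. AE \<omega> in M. f n \<omega> \<le> X n \<omega>"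
    "\<And>n. AE \<omega> in M. X n \<omega> \<le> X (Suc n) \<omega>"
    by auto
  have ess: "is_ess_sup M \<X> (ess_sup M \<X>)"
    by (rule is_ess_sup_ess_sup[OF meas ne])
  have "AE \<omega> in M. ess_sup M \<X> \<omega> = (SUP n. f n \<omega>)"
    by (rule ess_sup_unique[OF ess f(2)])
  moreover have "AE \<omega> in M. \<forall>n. f n \<omega> \<le> X n \<omega>"
    using X(2) by (simp add: AE_all_countable)
  moreover have "AE \<omega> in M. \<forall>n. X n \<omega> \<le> ess_sup M \<X> \<omega>"
    using X(1) ess by (auto simp: AE_all_countable is_ess_sup_def)
  ultimately have "AE \<omega> in M. ess_sup M \<X> \<omega> = (SUP n. X n \<omega>)"
  proof eventually_elim
    case (elim \<omega>)
    then show ?case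
      by (auto intro!: antisym SUP_least intro: SUP_upper2)
  qed
  then show ?thesis
    using that[of X] X by auto
qed

section \<open>Conditional expectations\<close>

lemma (in sigma_finite_subalgebra) nn_cond_exp_SUP:
  assumes mono: "\<And>n::nat. AE \<omega> in M. f n \<omega> \<le> f (Suc n) \<omega>"
    and [measurable]: "\<And>n. f n \<in> borel_measurable M"
  shows "AE \<omega> in M. (SUP n. nn_cond_exp M F (f n) \<omega>) = nn_cond_exp M F (\<lambda>\<omega>. SUP n. f n \<omega>) \<omega>"
proof (rule nn_cond_exp_charact)
  fix A assume A [measurable]: "A \<in> sets F"
  have [measurable]: "A \<in> sets M"
    using A subalg by (auto simp: subalgebra_def)
  have mono': "AE \<omega> in M. nn_cond_exp M F (f n) \<omega> \<le> nn_cond_exp M F (f (Suc n)) \<omega>" for n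
    by (rule nn_cond_exp_mono[OF mono]) auto
  have "(\<integral>\<^sup>+\<omega>\<in>A. (SUP n. f n \<omega>) \<partial>M) = (\<integral>\<^sup>+\<omega>. (SUP n. indicator A \<omega> * f n \<omega>) \<partial>M)"
    by (simp add: SUP_mult_left_ennreal mult.commute)
  also have "\<dots> = (SUP n. \<integral>\<^sup>+\<omega>. indicator A \<omega> * f n \<omega> \<partial>M)"
    by (intro nn_integral_monotone_convergence_SUP_AE
        eventually_mono[OF mono] mult_left_mono) auto
  also have "\<dots> = (SUP n. \<integral>\<^sup>+\<omega>. indicator A \<omega> * nn_cond_exp M F (f n) \<omega> \<partial>M)"
    by (simp add: nn_cond_exp_intg)
  also have "\<dots> = (\<integral>\<^sup>+\<omega>. (SUP n. indicator A \<omega> * nn_cond_exp M F (f n) \<omega>) \<partial>M)"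
    by (intro nn_integral_monotone_convergence_SUP_AE[symmetric]
        eventually_mono[OF mono'] mult_left_mono) auto
  also have "\<dots> = (\<integral>\<^sup>+\<omega>\<in>A. (SUP n. nn_cond_exp M F (f n) \<omega>) \<partial>M)"
    by (simp add: SUP_mult_left_ennreal mult.commute)
  finally show "(\<integral>\<^sup>+\<omega>\<in>A. (SUP n. f n \<omega>) \<partial>M) = (\<integral>\<^sup>+\<omega>\<in>A. (SUP n. nn_cond_exp M F (f n) \<omega>) \<partial>M)" .
qed auto

text \<open>
  Conditional expectations are local: on \<open>A\<close> they depend only on the integrand on \<open>A\<close> and on the
  trace of the \<open>\<sigma>\<close>-algebra on \<open>A\<close>, because both integrate the same way over subsets of \<open>A\<close>.
\<close>

lemma nn_cond_exp_local:
  assumes "finite_measure M" and G: "subalgebra M G" and H: "subalgebra M H"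
    and AG: "A \<in> sets G" and AH: "A \<in> sets H"
    and GH: "\<And>B. B \<in> sets G \<Longrightarrow> A \<inter> B \<in> sets H"
    and HG: "\<And>B. B \<in> sets H \<Longrightarrow> A \<inter> B \<in> sets G"
    and [measurable]: "f \<in> borel_measurable M" "g \<in> borel_measurable M"
    and eq: "AE \<omega> in M. \<omega> \<in> A \<longrightarrow> f \<omega> = g \<omega>"
  shows "AE \<omega> in M. \<omega> \<in> A \<longrightarrow> nn_cond_exp M G f \<omega> = nn_cond_exp M H g \<omega>"
proof -
  interpret finite_measure M by fact
  interpret G: finite_measure_subalgebra M G
    by unfold_locales (rule G)
  interpret H: finite_measure_subalgebra M H
    by unfold_locales (rule H)
  note [measurable] = AG AH
  have [measurable]: "A \<in> sets M"
    using AG G by (auto simp: subalgebra_def)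
  have spaces: "space G = space H"
    using G H by (simp add: subalgebra_def)
  have "(\<lambda>\<omega>. indicator A \<omega> * nn_cond_exp M H g \<omega>) \<in> borel_measurable G"
  proof (rule measurableI)
    fix U :: "ennreal set" assume U: "U \<in> sets borel"
    have "nn_cond_exp M H g -` U \<inter> space H \<in> sets H"
      using U by (intro measurable_sets[OF borel_measurable_nn_cond_exp])
    from HG[OF this] have 1: "A \<inter> (nn_cond_exp M H g -` U \<inter> space H) \<in> sets G" .
    have "(\<lambda>\<omega>. indicator A \<omega> * nn_cond_exp M H g \<omega>) -` U \<inter> space G =
        (A \<inter> (nn_cond_exp M H g -` U \<inter> space H)) \<union> (if 0 \<in> U then space G - A else {})"
      using sets.sets_into_space[OF AG] spaces
      by (auto simp: indicator_def of_bool_def split: if_splits)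
    then show "(\<lambda>\<omega>. indicator A \<omega> * nn_cond_exp M H g \<omega>) -` U \<inter> space G \<in> sets G"
      using 1 AG by auto
  qed auto
  then have "AE \<omega> in M. indicator A \<omega> * nn_cond_exp M H g \<omega>
      = nn_cond_exp M G (\<lambda>\<omega>. indicator A \<omega> * f \<omega>) \<omega>"
  proof (rule G.nn_cond_exp_charact[rotated 2])
    fix B assume B: "B \<in> sets G"
    have [measurable]: "A \<inter> B \<in> sets H"
      by (rule GH[OF B])
    have "(\<integral>\<^sup>+\<omega>\<in>B. indicator A \<omega> * f \<omega> \<partial>M) = (\<integral>\<^sup>+\<omega>. indicator (A \<inter> B) \<omega> * g \<omega> \<partial>M)"
      using eq by (intro nn_integral_cong_AE) (auto elim!: eventually_mono simp: indicator_def)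
    also have "\<dots> = (\<integral>\<^sup>+\<omega>. indicator (A \<inter> B) \<omega> * nn_cond_exp M H g \<omega> \<partial>M)"
      by (rule H.nn_cond_exp_intg[symmetric]) auto
    also have "\<dots> = (\<integral>\<^sup>+\<omega>\<in>B. indicator A \<omega> * nn_cond_exp M H g \<omega> \<partial>M)"
      by (intro nn_integral_cong) (auto simp: indicator_def)
    finally show "(\<integral>\<^sup>+\<omega>\<in>B. indicator A \<omega> * f \<omega> \<partial>M)
        = (\<integral>\<^sup>+\<omega>\<in>B. indicator A \<omega> * nn_cond_exp M H g \<omega> \<partial>M)" .
  qed measurable
  moreover have "AE \<omega> in M. indicator A \<omega> * nn_cond_exp M G f \<omega>
      = nn_cond_exp M G (\<lambda>\<omega>. indicator A \<omega> * f \<omega>) \<omega>"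
    by (rule G.nn_cond_exp_prod) auto
  ultimately show ?thesis
    by eventually_elim (auto simp: indicator_def)
qed

section \<open>Predictable times\<close>

context predictable_setup
begin

abbreviation pre :: "('a \<Rightarrow> real) \<Rightarrow> 'a measure"
  where "pre S \<equiv> strict_pre_sigma M F T S"

lemma sets_F_subset: "A \<in> sets (F t) \<Longrightarrow> A \<subseteq> space M"
  using sets.sets_into_space[of A "F t"] by (simp add: space_F)

lemma pre_generators:
  "sets (F 0) \<union> {A \<inter> {\<omega> \<in> space M. t < S \<omega>} | A t. t \<in> {0..T} \<and> A \<in> sets (F t)} \<subseteq> Pow (space M)"
  using sets_F_subset by auto

lemma space_pre [simp]: "space (pre S) = space M"
  using pre_generators[of S] by (simp add: strict_pre_sigma_def space_measure_of)

lemma sets_pre: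
  "sets (pre S) = sigma_sets (space M)
     (sets (F 0) \<union> {A \<inter> {\<omega> \<in> space M. t < S \<omega>} | A t. t \<in> {0..T} \<and> A \<in> sets (F t)})"
  using pre_generators[of S] by (simp add: strict_pre_sigma_def sets_measure_of)

lemma sets_F_0_pre: "A \<in> sets (F 0) \<Longrightarrow> A \<in> sets (pre S)"
  by (auto simp: sets_pre)

lemma null_sets_pre: "A \<in> null_sets M \<Longrightarrow> A \<in> sets (pre S)"
  using null_sets_F by (auto intro: sets_F_0_pre)

lemma sets_pre_before:
  "A \<in> sets (F t) \<Longrightarrow> t \<in> {0..T} \<Longrightarrow> A \<inter> {\<omega> \<in> space M. t < S \<omega>} \<in> sets (pre S)"
  unfolding sets_pre by (rule sigma_sets.Basic) auto

lemma pre_gt: "t \<in> {0..T} \<Longrightarrow> {\<omega> \<in> space M. t < S \<omega>} \<in> sets (pre S)"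
  using sets_pre_before[OF sets.top, of t S] by (auto simp: space_F Int_def)

lemma pre_induct [consumes 1, case_names null before empty compl union]:
  assumes "A \<in> sets (pre S)"
    and "\<And>A. A \<in> sets (F 0) \<Longrightarrow> P A"
    and "\<And>A t. A \<in> sets (F t) \<Longrightarrow> t \<in> {0..T} \<Longrightarrow> P (A \<inter> {\<omega> \<in> space M. t < S \<omega>})"
    and "P {}"
    and "\<And>A. A \<in> sets (pre S) \<Longrightarrow> P A \<Longrightarrow> P (space M - A)"
    and "\<And>A. (\<And>i::nat. A i \<in> sets (pre S)) \<Longrightarrow> (\<And>i. P (A i)) \<Longrightarrow> P (\<Union>i. A i)"
  shows "P A"
  using assms(1) unfolding sets_pre
proof induction
  case (Basic a)
  then show ?case
    using assms(2,3) by auto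
next
  case (Compl a)
  then show ?case
    using assms(5) by (auto simp: sets_pre)
next
  case (Union a)
  then show ?case
    using assms(6) by (auto simp: sets_pre)
qed (rule assms(4))

lemma pred_times_range: "\<tau> \<in> pred_times M F T \<Longrightarrow> \<omega> \<in> space M \<Longrightarrow> 0 \<le> \<tau> \<omega> \<and> \<tau> \<omega> \<le> T"
  by (auto simp: pred_times_def)

lemma pred_times_gt_F: "\<tau> \<in> pred_times M F T \<Longrightarrow> {\<omega> \<in> space M. t < \<tau> \<omega>} \<in> sets (F t)"
  using stopping_timeD2[of F \<tau> t] by (auto simp: pred_times_def pred_def space_F)

lemma pred_times_le_F: "\<tau> \<in> pred_times M F T \<Longrightarrow> {\<omega> \<in> space M. \<tau> \<omega> \<le> t} \<in> sets (F t)"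
  using stopping_timeD[of F \<tau> t] by (auto simp: pred_times_def pred_def space_F)

lemma subalgebra_pre:
  assumes S: "S \<in> pred_times M F T"
  shows "subalgebra M (pre S)"
proof -
  have F: "A \<in> sets M" if "A \<in> sets (F t)" "t \<in> {0..T}" for A t
    using subalgebra_F that by (auto simp: subalgebra_def)
  have "A \<in> sets M" if "A \<in> sets (pre S)" for A
    using that
  proof (induction rule: pre_induct)
    case (before A t)
    then show ?case
      using F[OF before] F[OF pred_times_gt_F[OF S] before(2)] by auto
  qed (use F[of _ 0] horizon_pos in auto)
  then show ?thesis
    by (auto simp: subalgebra_def)
qed

text \<open>
  An almost sure inequality suffices because the exceptional null sets all belong to \<open>F 0\<close>.
\<close>

lemma pre_mono:
  assumes S: "S \<in> pred_times M F T" and S': "S' \<in> pred_times M F T"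
    and le: "AE \<omega> in M. S \<omega> \<le> S' \<omega>"
  shows "sets (pre S) \<subseteq> sets (pre S')"
proof
  fix A assume "A \<in> sets (pre S)"
  then show "A \<in> sets (pre S')"
  proof (induction rule: pre_induct)
    case (null A)
    then show ?case
      by (rule sets_F_0_pre)
  next
    case (before A t)
    define B where "B = A \<inter> {\<omega> \<in> space M. t < S \<omega>}"
    have B: "B \<in> sets (F t)"
      unfolding B_def using before(1) pred_times_gt_F[OF S] by auto
    have "{\<omega> \<in> space M. \<not> S \<omega> \<le> S' \<omega>} \<in> null_sets M"
      using le by (simp add: AE_iff_null_sets)
    then have "B - {\<omega> \<in> space M. t < S' \<omega>} \<in> null_sets M"
      by (rule complete2[rotated]) (auto simp: B_def)
    then have "B \<inter> {\<omega> \<in> space M. t < S' \<omega>} \<union> (B - {\<omega> \<in> space M. t < S' \<omega>}) \<in> sets (pre S')"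
      using sets_pre_before[OF B before(2)] null_sets_pre by (intro sets.Un)
    also have "B \<inter> {\<omega> \<in> space M. t < S' \<omega>} \<union> (B - {\<omega> \<in> space M. t < S' \<omega>}) = B"
      by auto
    finally show ?case
      unfolding B_def .
  next
    case (compl A)
    then show ?case
      using sets.compl_sets[of A "pre S'"] by simp
  qed auto
qed

lemma measurable_pre_cong_AE:
  fixes f g :: "'a \<Rightarrow> ennreal"
  assumes f: "f \<in> borel_measurable (pre S)" and eq: "AE \<omega> in M. g \<omega> = f \<omega>"
  shows "g \<in> borel_measurable (pre S)"
proof (rule measurableI)
  fix U :: "ennreal set" assume "U \<in> sets borel"
  then have 1: "f -` U \<inter> space M \<in> sets (pre S)"
    using measurable_sets[OF f] by simp
  have N: "{\<omega> \<in> space M. \<not> g \<omega> = f \<omega>} \<in> null_sets M" (is "?N \<in> _")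
    using eq by (simp add: AE_iff_null_sets)
  have "g -` U \<inter> space M = (f -` U \<inter> space M - ?N) \<union> (g -` U \<inter> ?N)"
    by auto
  moreover have "g -` U \<inter> ?N \<in> null_sets M"
    using N by (rule complete2[rotated]) auto
  ultimately show "g -` U \<inter> space (pre S) \<in> sets (pre S)"
    using 1 null_sets_pre[OF N] null_sets_pre by auto
qed auto

subsection \<open>Sections of predictable sets\<close>

lemma predictable_generators:
  "{A \<times> {0} | A. A \<in> sets (F 0)} \<union>
      {A \<times> {s<..t} | A s t. 0 \<le> s \<and> s < t \<and> t \<le> T \<and> A \<in> sets (F s)} \<subseteq> Pow (space M \<times> {0..T})"
  using sets_F_subset horizon_pos by fastforce

lemma sets_predictable_zero: "A \<in> sets (F 0) \<Longrightarrow> A \<times> {0} \<in> sets (predictable_sigma M F T)"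
  unfolding predictable_sigma_def sets_measure_of[OF predictable_generators]
  by (rule sigma_sets.Basic) auto

lemma sets_predictable_Ioc:
  assumes "A \<in> sets (F s)" "0 \<le> s"
  shows "A \<times> {s<..T} \<in> sets (predictable_sigma M F T)"
proof (cases "s < T")
  case True
  then show ?thesis
    unfolding predictable_sigma_def sets_measure_of[OF predictable_generators] using assms
    by (intro sigma_sets.Basic) auto
qed auto

lemma sets_predictable_start:
  assumes "A \<in> sets (F 0)"
  shows "A \<times> {0..T} \<in> sets (predictable_sigma M F T)"
proof -
  have "A \<times> {0..T} = A \<times> {0} \<union> A \<times> {0<..T}"
    using horizon_pos by auto
  then show ?thesis
    using sets_predictable_zero[OF assms] sets_predictable_Ioc[OF assms] by auto
qed

text \<open>
  The link between predictability and the events strictly before \<open>S\<close>: since the generating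
  rectangles are open on the left, the event that \<open>S\<close> falls into \<open>{s<..t}\<close> only involves \<open>s < S\<close>
  and \<open>t < S\<close>.
\<close>

lemma measurable_predictable_at:
  assumes range: "\<And>\<omega>. \<omega> \<in> space M \<Longrightarrow> S \<omega> \<in> {0..T}"
  shows "(\<lambda>\<omega>. (\<omega>, S \<omega>)) \<in> measurable (pre S) (predictable_sigma M F T)"
  unfolding predictable_sigma_def
proof (rule measurable_measure_of[OF predictable_generators])
  show "(\<lambda>\<omega>. (\<omega>, S \<omega>)) \<in> space (pre S) \<rightarrow> space M \<times> {0..T}"
    using range by auto
next
  fix Y assume "Y \<in> {A \<times> {0} | A. A \<in> sets (F 0)} \<union>
      {A \<times> {s<..t} | A s t. 0 \<le> s \<and> s < t \<and> t \<le> T \<and> A \<in> sets (F s)}"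
  then consider A where "Y = A \<times> {0}" "A \<in> sets (F 0)"
    | A s t where "Y = A \<times> {s<..t}" "0 \<le> s" "s < t" "t \<le> T" "A \<in> sets (F s)"
    by auto
  then show "(\<lambda>\<omega>. (\<omega>, S \<omega>)) -` Y \<inter> space (pre S) \<in> sets (pre S)"
  proof cases
    case 1
    have "(\<lambda>\<omega>. (\<omega>, S \<omega>)) -` Y \<inter> space (pre S) = A - {\<omega> \<in> space M. 0 < S \<omega>}"
      using 1 sets_F_subset[OF 1(2)] range by force
    then show ?thesis
      using sets_F_0_pre[OF 1(2)] pre_gt[of 0 S] horizon_pos by auto
  next
    case 2
    have "(\<lambda>\<omega>. (\<omega>, S \<omega>)) -` Y \<inter> space (pre S)
        = A \<inter> {\<omega> \<in> space M. s < S \<omega>} - {\<omega> \<in> space M. t < S \<omega>}"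
      using 2 by auto
    then show ?thesis
      using sets_pre_before[of A s S] pre_gt[of t S] 2 by auto
  qed
qed

lemma measurable_predictable_section:
  assumes t: "t \<in> {0..T}"
  shows "(\<lambda>\<omega>. (\<omega>, t)) \<in> measurable (F t) (predictable_sigma M F T)"
  unfolding predictable_sigma_def
proof (rule measurable_measure_of[OF predictable_generators])
  show "(\<lambda>\<omega>. (\<omega>, t)) \<in> space (F t) \<rightarrow> space M \<times> {0..T}"
    using t by (auto simp: space_F)
next
  fix Y assume "Y \<in> {A \<times> {0} | A. A \<in> sets (F 0)} \<union>
      {A \<times> {s<..t} | A s t. 0 \<le> s \<and> s < t \<and> t \<le> T \<and> A \<in> sets (F s)}"
  then obtain A s J where Y: "Y = A \<times> J" "A \<in> sets (F s)" "t \<in> J \<longrightarrow> s \<le> t"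
    by auto
  then have "(\<lambda>\<omega>. (\<omega>, t)) -` Y \<inter> space (F t) = (if t \<in> J then A else {})"
    using sets_F_subset by (auto simp: space_F)
  then show "(\<lambda>\<omega>. (\<omega>, t)) -` Y \<inter> space (F t) \<in> sets (F t)"
    using Y sets_F_mono[of s t] by auto
qed

subsection \<open>Gluing predictable times\<close>

text \<open>
  The stopping property comes for free, since the section at \<open>t\<close> of a predictable set lies in
  \<open>F t\<close>.
\<close>

lemma pred_timesI:
  assumes range: "\<And>\<omega>. \<omega> \<in> space M \<Longrightarrow> \<tau> \<omega> \<in> {0..T}"
    and epi: "{(\<omega>, t). \<omega> \<in> space M \<and> t \<in> {0..T} \<and> \<tau> \<omega> \<le> t} \<in> sets (predictable_sigma M F T)"
  shows "\<tau> \<in> pred_times M F T"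
proof -
  have "{\<omega> \<in> space M. \<tau> \<omega> \<le> t} \<in> sets (F t)" for t
  proof -
    consider "t < 0" | "t \<in> {0..T}" | "T < t"
      by fastforce
    then show ?thesis
    proof cases
      case 1
      then have empty: "{\<omega> \<in> space M. \<tau> \<omega> \<le> t} = {}"
        using range by fastforce
      show ?thesis
        unfolding empty by simp
    next
      case 2
      have cut: "(\<lambda>\<omega>. (\<omega>, t)) -` {(\<omega>, t). \<omega> \<in> space M \<and> t \<in> {0..T} \<and> \<tau> \<omega> \<le> t} \<inter> space (F t)
          = {\<omega> \<in> space M. \<tau> \<omega> \<le> t}"
        using 2 by (auto simp: space_F)
      show ?thesis
        using measurable_sets[OF measurable_predictable_section[OF 2] epi] unfolding cut .
    next
      case 3
      then have full: "{\<omega> \<in> space M. \<tau> \<omega> \<le> t} = space (F t)"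
        using range by (fastforce simp: space_F)
      show ?thesis
        unfolding full by simp
    qed
  qed
  then show ?thesis
    using assms by (auto simp: pred_times_def stopping_time_def pred_def space_F)
qed

lemma pred_times_horizon: "(\<lambda>_. T) \<in> pred_times M F T"
proof (rule pred_timesI)
  define s where "s = (\<lambda>n::nat. T - T / (n + 1))"
  have s: "0 \<le> s n" "s n < T" for n
    using horizon_pos by (auto simp: s_def field_simps)
  have lim: "s \<longlonglongrightarrow> T"
    unfolding s_def by real_asymp
  have "{(\<omega>, t). \<omega> \<in> space M \<and> t \<in> {0..T} \<and> T \<le> t} = (\<Inter>n. space M \<times> {s n<..T})"
  proof (intro equalityI subsetI)
    fix x assume "x \<in> (\<Inter>n. space M \<times> {s n<..T})"
    then obtain \<omega> t where x: "x = (\<omega>, t)" "\<omega> \<in> space M" "t \<le> T" "\<And>n. s n < t"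
      by (cases x) auto
    moreover have "T \<le> t"
      using x(4) by (intro LIMSEQ_le_const2[OF lim]) (auto intro: less_imp_le)
    ultimately show "x \<in> {(\<omega>, t). \<omega> \<in> space M \<and> t \<in> {0..T} \<and> T \<le> t}"
      using horizon_pos by auto
  next
    fix x assume "x \<in> {(\<omega>, t). \<omega> \<in> space M \<and> t \<in> {0..T} \<and> T \<le> t}"
    then show "x \<in> (\<Inter>n. space M \<times> {s n<..T})"
      using s by fastforce
  qed
  moreover have "space M \<times> {s n<..T} \<in> sets (predictable_sigma M F T)" for n
    using sets_predictable_Ioc[OF sets.top, of "s n"] s by (simp add: space_F)
  ultimately show "{(\<omega>, t). \<omega> \<in> space M \<and> t \<in> {0..T} \<and> T \<le> t} \<in> sets (predictable_sigma M F T)"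
    by auto
qed (use horizon_pos in auto)

text \<open>
  From \<open>\<theta>\<close> on, an event known strictly before \<open>\<theta>\<close> is a predictable condition: an event
  \<open>A \<inter> {t < \<theta>}\<close> with \<open>A\<close> in \<open>F t\<close> belongs to \<open>F t\<close>, and only times after \<open>t\<close> are concerned.
\<close>

lemma predictable_restrict:
  assumes \<theta>: "\<theta> \<in> pred_times M F T" and A: "A \<in> sets (pre \<theta>)"
  shows "{(\<omega>, t). \<omega> \<in> A \<and> t \<in> {0..T} \<and> \<theta> \<omega> \<le> t} \<in> sets (predictable_sigma M F T)"
proof -
  define E where "E = {(\<omega>, t). \<omega> \<in> space M \<and> t \<in> {0..T} \<and> \<theta> \<omega> \<le> t}"
  have E: "E \<in> sets (predictable_sigma M F T)"
    using \<theta> by (simp add: pred_times_def E_def)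
  have "(A \<times> {0..T}) \<inter> E \<in> sets (predictable_sigma M F T)"
    using A
  proof (induction rule: pre_induct)
    case (null A)
    then show ?case
      using sets_predictable_start E by auto
  next
    case (before A t)
    define B where "B = A \<inter> {\<omega> \<in> space M. t < \<theta> \<omega>}"
    have "B \<in> sets (F t)"
      unfolding B_def using before(1) pred_times_gt_F[OF \<theta>] by auto
    then have "B \<times> {t<..T} \<inter> E \<in> sets (predictable_sigma M F T)"
      using before(2) sets_predictable_Ioc E by auto
    also have "B \<times> {t<..T} \<inter> E = (B \<times> {0..T}) \<inter> E"
      using before(2) by (auto simp: B_def E_def)
    finally show ?case
      unfolding B_def .
  next
    case (compl A)
    have "((space M - A) \<times> {0..T}) \<inter> E = E - (A \<times> {0..T}) \<inter> E"
      by (auto simp: E_def)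
    then show ?case
      using compl E by auto
  next
    case (union A)
    have "((\<Union>i. A i) \<times> {0..T}) \<inter> E = (\<Union>i. (A i \<times> {0..T}) \<inter> E)"
      by auto
    then show ?case
      using union(2) by (simp only:) (intro sets.countable_UN, auto)
  qed auto
  also have "(A \<times> {0..T}) \<inter> E = {(\<omega>, t). \<omega> \<in> A \<and> t \<in> {0..T} \<and> \<theta> \<omega> \<le> t}"
    using sets.sets_into_space[OF A] by (auto simp: E_def)
  finally show ?thesis .
qed

lemma pred_times_glue:
  assumes \<theta>: "\<theta> \<in> pred_times M F T" and \<theta>': "\<theta>' \<in> pred_times M F T"
    and A: "A \<in> sets (pre \<theta>)" and A': "A \<in> sets (pre \<theta>')"
  shows "(\<lambda>\<omega>. if \<omega> \<in> A then \<theta> \<omega> else \<theta>' \<omega>) \<in> pred_times M F T"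
proof (rule pred_timesI)
  have "{(\<omega>, t). \<omega> \<in> A \<and> t \<in> {0..T} \<and> \<theta> \<omega> \<le> t} \<union>
      {(\<omega>, t). \<omega> \<in> space M - A \<and> t \<in> {0..T} \<and> \<theta>' \<omega> \<le> t} \<in> sets (predictable_sigma M F T)"
    using predictable_restrict[OF \<theta> A] predictable_restrict[OF \<theta>', of "space M - A"]
      sets.compl_sets[OF A'] by simp
  also have "{(\<omega>, t). \<omega> \<in> A \<and> t \<in> {0..T} \<and> \<theta> \<omega> \<le> t} \<union>
      {(\<omega>, t). \<omega> \<in> space M - A \<and> t \<in> {0..T} \<and> \<theta>' \<omega> \<le> t}
      = {(\<omega>, t). \<omega> \<in> space M \<and> t \<in> {0..T} \<and> (if \<omega> \<in> A then \<theta> \<omega> else \<theta>' \<omega>) \<le> t}"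
    using sets.sets_into_space[OF A] by (auto split: if_splits)
  finally show "{(\<omega>, t). \<omega> \<in> space M \<and> t \<in> {0..T} \<and> (if \<omega> \<in> A then \<theta> \<omega> else \<theta>' \<omega>) \<le> t}
      \<in> sets (predictable_sigma M F T)" .
qed (use pred_times_range[OF \<theta>] pred_times_range[OF \<theta>'] in auto)

subsection \<open>The event that two predictable times coincide\<close>

text \<open>
  One inequality is the evaluation of the predictable set of times from \<open>\<tau>'\<close> on at time \<open>\<tau>\<close>; this is
  where predictability enters, since for general stopping times \<open>\<tau> = \<tau>'\<close> need not be known strictly
  before \<open>\<tau>\<close>. The other one is seen at a rational time strictly between \<open>\<tau>'\<close> and \<open>\<tau>\<close>.
\<close>

lemma eq_event_pre:
  assumes \<tau>: "\<tau> \<in> pred_times M F T" and \<tau>': "\<tau>' \<in> pred_times M F T"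
  shows "{\<omega> \<in> space M. \<tau> \<omega> = \<tau>' \<omega>} \<in> sets (pre \<tau>)"
proof -
  define E where "E = {(\<omega>, t). \<omega> \<in> space M \<and> t \<in> {0..T} \<and> \<tau>' \<omega> \<le> t}"
  have "E \<in> sets (predictable_sigma M F T)"
    using \<tau>' by (simp add: pred_times_def E_def)
  from measurable_sets[OF measurable_predictable_at this, of \<tau>]
  have "(\<lambda>\<omega>. (\<omega>, \<tau> \<omega>)) -` E \<inter> space M \<in> sets (pre \<tau>)"
    using pred_times_range[OF \<tau>] by simp
  also have "(\<lambda>\<omega>. (\<omega>, \<tau> \<omega>)) -` E \<inter> space M = {\<omega> \<in> space M. \<tau>' \<omega> \<le> \<tau> \<omega>}"
    using pred_times_range[OF \<tau>] by (auto simp: E_def)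
  finally have le: "{\<omega> \<in> space M. \<tau>' \<omega> \<le> \<tau> \<omega>} \<in> sets (pre \<tau>)" .
  have "{\<omega> \<in> space M. \<tau>' \<omega> \<le> of_rat q} \<inter> {\<omega> \<in> space M. of_rat q < \<tau> \<omega>} \<in> sets (pre \<tau>)"
    if "of_rat q \<in> {0..T}" for q
    using pred_times_le_F[OF \<tau>'] that by (rule sets_pre_before)
  then have "(\<Union>q\<in>{q. of_rat q \<in> {0..T}}.
      {\<omega> \<in> space M. \<tau>' \<omega> \<le> of_rat q} \<inter> {\<omega> \<in> space M. of_rat q < \<tau> \<omega>}) \<in> sets (pre \<tau>)"
    by (intro sets.countable_UN') auto
  also have "(\<Union>q\<in>{q. of_rat q \<in> {0..T}}.
      {\<omega> \<in> space M. \<tau>' \<omega> \<le> of_rat q} \<inter> {\<omega> \<in> space M. of_rat q < \<tau> \<omega>})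
      = {\<omega> \<in> space M. \<tau>' \<omega> < \<tau> \<omega>}"
  proof (intro equalityI subsetI)
    fix \<omega> assume "\<omega> \<in> {\<omega> \<in> space M. \<tau>' \<omega> < \<tau> \<omega>}"
    then have \<omega>: "\<omega> \<in> space M" "\<tau>' \<omega> < \<tau> \<omega>"
      by auto
    then obtain q where q: "\<tau>' \<omega> < of_rat q" "of_rat q < \<tau> \<omega>"
      using of_rat_dense by blast
    have "0 \<le> (of_rat q :: real)" "of_rat q \<le> T"
      using q pred_times_range[OF \<tau> \<omega>(1)] pred_times_range[OF \<tau>' \<omega>(1)] by linarith+
    then have "of_rat q \<in> {0..T}"
      by (rule atLeastAtMost_iff[THEN iffD2, OF conjI])
    then show "\<omega> \<in> (\<Union>q\<in>{q. of_rat q \<in> {0..T}}.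
        {\<omega> \<in> space M. \<tau>' \<omega> \<le> of_rat q} \<inter> {\<omega> \<in> space M. of_rat q < \<tau> \<omega>})"
      using \<omega>(1) q by (intro UN_I[of q]) auto
  qed auto
  finally have "{\<omega> \<in> space M. \<tau>' \<omega> < \<tau> \<omega>} \<in> sets (pre \<tau>)" .
  with le have "{\<omega> \<in> space M. \<tau>' \<omega> \<le> \<tau> \<omega>} - {\<omega> \<in> space M. \<tau>' \<omega> < \<tau> \<omega>} \<in> sets (pre \<tau>)"
    by (rule sets.Diff)
  also have "{\<omega> \<in> space M. \<tau>' \<omega> \<le> \<tau> \<omega>} - {\<omega> \<in> space M. \<tau>' \<omega> < \<tau> \<omega>} = {\<omega> \<in> space M. \<tau> \<omega> = \<tau>' \<omega>}"
    by auto
  finally show ?thesis .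
qed

lemma pre_trace_eq:
  assumes \<tau>: "\<tau> \<in> pred_times M F T" and \<tau>': "\<tau>' \<in> pred_times M F T" and B: "B \<in> sets (pre \<tau>')"
  shows "{\<omega> \<in> space M. \<tau> \<omega> = \<tau>' \<omega>} \<inter> B \<in> sets (pre \<tau>)"
proof -
  define A where "A = {\<omega> \<in> space M. \<tau> \<omega> = \<tau>' \<omega>}"
  have A: "A \<in> sets (pre \<tau>)"
    unfolding A_def by (rule eq_event_pre[OF \<tau> \<tau>'])
  have "A \<inter> B \<in> sets (pre \<tau>)"
    using B
  proof (induction rule: pre_induct)
    case (null B)
    then show ?case
      using sets.Int[OF A sets_F_0_pre] by simp
  next
    case (before B t)
    have "A \<inter> (B \<inter> {\<omega> \<in> space M. t < \<tau>' \<omega>}) = A \<inter> (B \<inter> {\<omega> \<in> space M. t < \<tau> \<omega>})"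
      by (auto simp: A_def)
    then show ?case
      using sets.Int[OF A sets_pre_before[OF before, of \<tau>]] by simp
  next
    case (compl B)
    have "A \<inter> (space M - B) = A - A \<inter> B"
      by (auto simp: A_def)
    then show ?case
      using sets.Diff[OF A compl(2)] by simp
  next
    case (union B)
    have "A \<inter> (\<Union>i. B i) = (\<Union>i. A \<inter> B i)"
      by auto
    then show ?case
      using union(2) by (simp only:) (intro sets.countable_UN, auto)
  qed simp
  then show ?thesis
    by (simp add: A_def)
qed

end

section \<open>The value of optimal stopping\<close>

text \<open>
  \<open>R s t\<close> means that stopping at \<open>t\<close> is allowed from the present \<open>s\<close>. With \<open>s \<le> t\<close> this gives the
  value family, with \<open>s < t\<close> before the horizon and \<open>t = T\<close> at the horizon the strict one. As the
  constraint is pointwise in \<open>\<omega>\<close>, gluing preserves it.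
\<close>

locale predictable_stopping = predictable_setup +
  fixes \<phi> :: "('a \<Rightarrow> real) \<Rightarrow> 'a \<Rightarrow> ennreal" and R :: "real \<Rightarrow> real \<Rightarrow> bool"
  assumes admissible: "admissible_family M F T (pred_times M F T) \<phi>"
    and R_le: "\<And>s t. s \<in> {0..T} \<Longrightarrow> t \<in> {0..T} \<Longrightarrow> R s t \<Longrightarrow> s \<le> t"
    and R_antimono: "\<And>s s' t. 0 \<le> s \<Longrightarrow> s \<le> s' \<Longrightarrow> s' \<le> T \<Longrightarrow> R s' t \<Longrightarrow> R s t"
    and R_horizon: "\<And>s. s \<in> {0..T} \<Longrightarrow> R s T"
begin

definition later_times :: "('a \<Rightarrow> real) \<Rightarrow> ('a \<Rightarrow> real) set"
  where "later_times S = {\<theta> \<in> pred_times M F T. AE \<omega> in M. R (S \<omega>) (\<theta> \<omega>)}"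

definition rewards :: "('a \<Rightarrow> real) \<Rightarrow> ('a \<Rightarrow> ennreal) set"
  where "rewards S = {nn_cond_exp M (pre S) (\<phi> \<tau>) | \<tau>. \<tau> \<in> later_times S}"

definition val :: "('a \<Rightarrow> real) \<Rightarrow> 'a \<Rightarrow> ennreal"
  where "val S = ess_sup M (rewards S)"

lemma later_times_pred: "\<theta> \<in> later_times S \<Longrightarrow> \<theta> \<in> pred_times M F T"
  by (simp add: later_times_def)

lemma later_times_ge:
  assumes S: "S \<in> pred_times M F T" and \<theta>: "\<theta> \<in> later_times S"
  shows "AE \<omega> in M. S \<omega> \<le> \<theta> \<omega>"
proof -
  have "AE \<omega> in M. R (S \<omega>) (\<theta> \<omega>)"
    using \<theta> by (simp add: later_times_def)
  with AE_space show ?thesis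
  proof eventually_elim
    case (elim \<omega>)
    then show ?case
      using R_le[of "S \<omega>" "\<theta> \<omega>"] pred_times_range[OF S] pred_times_range[OF later_times_pred[OF \<theta>]]
      by simp
  qed
qed

lemma horizon_later: "S \<in> pred_times M F T \<Longrightarrow> (\<lambda>_. T) \<in> later_times S"
  using pred_times_horizon R_horizon pred_times_range by (auto simp: later_times_def)

lemma later_times_antimono:
  assumes S: "S \<in> pred_times M F T" and S': "S' \<in> pred_times M F T"
    and le: "AE \<omega> in M. S \<omega> \<le> S' \<omega>"
  shows "later_times S' \<subseteq> later_times S"
proof
  fix \<theta> assume \<theta>: "\<theta> \<in> later_times S'"
  then have "AE \<omega> in M. R (S' \<omega>) (\<theta> \<omega>)"
    by (simp add: later_times_def)
  with AE_space le have "AE \<omega> in M. R (S \<omega>) (\<theta> \<omega>)"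
  proof eventually_elim
    case (elim \<omega>)
    then show ?case
      using R_antimono pred_times_range[OF S] pred_times_range[OF S'] by blast
  qed
  then show "\<theta> \<in> later_times S"
    using \<theta> by (simp add: later_times_def)
qed

lemma phi_measurable_pre: "\<tau> \<in> pred_times M F T \<Longrightarrow> \<phi> \<tau> \<in> borel_measurable (pre \<tau>)"
  using admissible by (simp add: admissible_family_def)

lemma phi_measurable [measurable]: "\<tau> \<in> pred_times M F T \<Longrightarrow> \<phi> \<tau> \<in> borel_measurable M"
  by (rule measurable_from_subalg[OF subalgebra_pre phi_measurable_pre])

lemma phi_eq:
  "\<tau> \<in> pred_times M F T \<Longrightarrow> \<tau>' \<in> pred_times M F T \<Longrightarrow> AE \<omega> in M. \<tau> \<omega> = \<tau>' \<omega> \<longrightarrow> \<phi> \<tau> \<omega> = \<phi> \<tau>' \<omega>"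
  using admissible unfolding admissible_family_def by blast

lemma rewards_measurable: "rewards S \<subseteq> borel_measurable M"
  by (auto simp: rewards_def)

lemma rewards_nonempty: "S \<in> pred_times M F T \<Longrightarrow> rewards S \<noteq> {}"
  using horizon_later by (auto simp: rewards_def)

lemma is_ess_sup_val: "S \<in> pred_times M F T \<Longrightarrow> is_ess_sup M (rewards S) (val S)"
  unfolding val_def by (intro is_ess_sup_ess_sup rewards_measurable rewards_nonempty)

lemma val_upper:
  "S \<in> pred_times M F T \<Longrightarrow> \<theta> \<in> later_times S \<Longrightarrow>
    AE \<omega> in M. nn_cond_exp M (pre S) (\<phi> \<theta>) \<omega> \<le> val S \<omega>"
  using is_ess_sup_val by (auto simp: is_ess_sup_def rewards_def)

lemma val_least:
  assumes "S \<in> pred_times M F T" "Z \<in> borel_measurable M"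
    and "\<And>\<theta>. \<theta> \<in> later_times S \<Longrightarrow> AE \<omega> in M. nn_cond_exp M (pre S) (\<phi> \<theta>) \<omega> \<le> Z \<omega>"
  shows "AE \<omega> in M. val S \<omega> \<le> Z \<omega>"
  using is_ess_sup_val[OF assms(1)] assms(2,3) unfolding is_ess_sup_def rewards_def by blast

lemma cond_exp_phi_local:
  assumes S: "S \<in> pred_times M F T" and "\<theta> \<in> pred_times M F T" "\<theta>' \<in> pred_times M F T"
    and A: "A \<in> sets (pre S)" and eq: "\<And>\<omega>. \<omega> \<in> A \<Longrightarrow> \<theta> \<omega> = \<theta>' \<omega>"
  shows "AE \<omega> in M. \<omega> \<in> A \<longrightarrow>
    nn_cond_exp M (pre S) (\<phi> \<theta>) \<omega> = nn_cond_exp M (pre S) (\<phi> \<theta>') \<omega>"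
proof (rule nn_cond_exp_local)
  show "AE \<omega> in M. \<omega> \<in> A \<longrightarrow> \<phi> \<theta> \<omega> = \<phi> \<theta>' \<omega>"
    using phi_eq[OF assms(2,3)] by eventually_elim (auto simp: eq)
qed (use assms subalgebra_pre finite_measure_axioms in auto)

text \<open>
  Of two later times, at time \<open>S\<close> one knows which promises the larger conditional reward;
  gluing the two along this event attains the maximum of the two rewards.
\<close>

lemma rewards_directed:
  assumes S: "S \<in> pred_times M F T" and X: "X \<in> rewards S" and Y: "Y \<in> rewards S"
  shows "\<exists>Z\<in>rewards S. AE \<omega> in M. X \<omega> \<le> Z \<omega> \<and> Y \<omega> \<le> Z \<omega>"
proof -
  obtain \<theta> \<theta>' where \<theta>: "\<theta> \<in> later_times S" "X = nn_cond_exp M (pre S) (\<phi> \<theta>)"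
    and \<theta>': "\<theta>' \<in> later_times S" "Y = nn_cond_exp M (pre S) (\<phi> \<theta>')"
    using X Y by (auto simp: rewards_def)
  have [measurable]: "X \<in> borel_measurable (pre S)" "Y \<in> borel_measurable (pre S)"
    by (auto simp: \<theta> \<theta>')
  define A where "A = {\<omega> \<in> space (pre S). Y \<omega> \<le> X \<omega>}"
  have A: "A \<in> sets (pre S)"
    unfolding A_def by measurable
  define \<rho> where "\<rho> = (\<lambda>\<omega>. if \<omega> \<in> A then \<theta> \<omega> else \<theta>' \<omega>)"
  note pred = later_times_pred[OF \<theta>(1)] later_times_pred[OF \<theta>'(1)]
  have "A \<in> sets (pre \<theta>)" "A \<in> sets (pre \<theta>')"
    using A pre_mono[OF S] later_times_ge[OF S] pred \<theta>(1) \<theta>'(1) by blast+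
  then have \<rho>_pred: "\<rho> \<in> pred_times M F T"
    unfolding \<rho>_def using pred by (intro pred_times_glue)
  have "AE \<omega> in M. R (S \<omega>) (\<theta> \<omega>)" "AE \<omega> in M. R (S \<omega>) (\<theta>' \<omega>)"
    using \<theta>(1) \<theta>'(1) by (auto simp: later_times_def)
  then have "AE \<omega> in M. R (S \<omega>) (\<rho> \<omega>)"
    by eventually_elim (auto simp: \<rho>_def)
  then have \<rho>: "\<rho> \<in> later_times S"
    using \<rho>_pred by (simp add: later_times_def)
  define Z where "Z = nn_cond_exp M (pre S) (\<phi> \<rho>)"
  have "AE \<omega> in M. \<omega> \<in> A \<longrightarrow> X \<omega> = Z \<omega>"
    unfolding \<theta>(2) Z_def using pred A \<rho>_pred
    by (intro cond_exp_phi_local[OF S]) (auto simp: \<rho>_def)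
  moreover have "AE \<omega> in M. \<omega> \<in> space M - A \<longrightarrow> Y \<omega> = Z \<omega>"
    unfolding \<theta>'(2) Z_def using pred sets.compl_sets[OF A] \<rho>_pred
    by (intro cond_exp_phi_local[OF S]) (auto simp: \<rho>_def)
  ultimately have "AE \<omega> in M. X \<omega> \<le> Z \<omega> \<and> Y \<omega> \<le> Z \<omega>"
    using AE_space
  proof eventually_elim
    case (elim \<omega>)
    then show ?case
      by (cases "\<omega> \<in> A") (auto simp: A_def)
  qed
  moreover have "Z \<in> rewards S"
    using \<rho> by (auto simp: Z_def rewards_def)
  ultimately show ?thesis
    by blast
qed

lemma val_maximizing_sequence:
  assumes S: "S \<in> pred_times M F T"
  obtains \<theta> :: "nat \<Rightarrow> 'a \<Rightarrow> real"
  where "\<And>n. \<theta> n \<in> later_times S"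
    "\<And>n. AE \<omega> in M. nn_cond_exp M (pre S) (\<phi> (\<theta> n)) \<omega> \<le> nn_cond_exp M (pre S) (\<phi> (\<theta> (Suc n))) \<omega>"
    "AE \<omega> in M. val S \<omega> = (SUP n. nn_cond_exp M (pre S) (\<phi> (\<theta> n)) \<omega>)"
proof -
  obtain X :: "nat \<Rightarrow> 'a \<Rightarrow> ennreal" where X: "range X \<subseteq> rewards S"
    "\<And>n. AE \<omega> in M. X n \<omega> \<le> X (Suc n) \<omega>" "AE \<omega> in M. val S \<omega> = (SUP n. X n \<omega>)"
    unfolding val_def
  proof (rule directed_ess_sup[OF rewards_measurable rewards_nonempty[OF S]])
    show "\<exists>Z\<in>rewards S. AE \<omega> in M. X \<omega> \<le> Z \<omega> \<and> Y \<omega> \<le> Z \<omega>" if "X \<in> rewards S" "Y \<in> rewards S" for X Y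
      by (rule rewards_directed[OF S that])
  qed (rule that[unfolded val_def])
  have "\<exists>\<theta>\<in>later_times S. X n = nn_cond_exp M (pre S) (\<phi> \<theta>)" for n
    using X(1) by (auto simp: rewards_def)
  then obtain \<theta> where "\<And>n. \<theta> n \<in> later_times S" "\<And>n. X n = nn_cond_exp M (pre S) (\<phi> (\<theta> n))"
    by metis
  then show ?thesis
    using that[of \<theta>] X by simp
qed

text \<open>
  The essential supremum is chosen among the \<open>M\<close>-measurable versions; as the null sets belong to
  \<open>F 0\<close>, every version is measurable strictly before \<open>S\<close>.
\<close>

lemma val_measurable_pre:
  assumes S: "S \<in> pred_times M F T"
  shows "val S \<in> borel_measurable (pre S)"
proof -
  obtain \<theta> :: "nat \<Rightarrow> 'a \<Rightarrow> real"
    where "AE \<omega> in M. val S \<omega> = (SUP n. nn_cond_exp M (pre S) (\<phi> (\<theta> n)) \<omega>)"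
    by (rule val_maximizing_sequence[OF S]) (rule that)
  then show ?thesis
    by (rule measurable_pre_cong_AE[rotated]) measurable
qed

text \<open>
  A time \<open>\<theta>\<close> allowed from \<open>S\<close> becomes one allowed from \<open>S'\<close> if it is replaced by the horizon off
  the event \<open>S = S'\<close>, and by locality its conditional reward does not change on that event. So the
  value at \<open>S'\<close>, made infinite off the event, bounds all rewards at \<open>S\<close>.
\<close>

lemma val_le_on_eq:
  assumes S: "S \<in> pred_times M F T" and S': "S' \<in> pred_times M F T"
  shows "AE \<omega> in M. S \<omega> = S' \<omega> \<longrightarrow> val S \<omega> \<le> val S' \<omega>"
proof -
  define A where "A = {\<omega> \<in> space M. S \<omega> = S' \<omega>}"
  have A: "A \<in> sets (pre S)"
    unfolding A_def by (rule eq_event_pre[OF S S'])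
  have A_sym: "A = {\<omega> \<in> space M. S' \<omega> = S \<omega>}"
    by (auto simp: A_def)
  have A': "A \<in> sets (pre S')"
    unfolding A_sym by (rule eq_event_pre[OF S' S])
  have [measurable]: "A \<in> sets M"
    using A subalgebra_pre[OF S] by (auto simp: subalgebra_def)
  have [measurable]: "val S' \<in> borel_measurable M"
    by (rule measurable_from_subalg[OF subalgebra_pre val_measurable_pre]; fact)
  have "AE \<omega> in M. val S \<omega> \<le> (if \<omega> \<in> A then val S' \<omega> else top)"
  proof (rule val_least[OF S])
    fix \<theta> assume \<theta>: "\<theta> \<in> later_times S"
    note \<theta>_pred = later_times_pred[OF \<theta>]
    define \<rho> where "\<rho> = (\<lambda>\<omega>. if \<omega> \<in> A then \<theta> \<omega> else T)"
    have "A \<in> sets (pre \<theta>)"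
      using A pre_mono[OF S \<theta>_pred later_times_ge[OF S \<theta>]] by blast
    moreover have "A \<in> sets (pre (\<lambda>_. T))"
      using A pre_mono[OF S pred_times_horizon] later_times_ge[OF S horizon_later[OF S]] by blast
    ultimately have \<rho>_pred: "\<rho> \<in> pred_times M F T"
      unfolding \<rho>_def by (intro pred_times_glue \<theta>_pred pred_times_horizon)
    have "AE \<omega> in M. R (S \<omega>) (\<theta> \<omega>)"
      using \<theta> by (simp add: later_times_def)
    with AE_space have "AE \<omega> in M. R (S' \<omega>) (\<rho> \<omega>)"
    proof eventually_elim
      case (elim \<omega>)
      then show ?case
        using pred_times_range[OF S'] R_horizon by (auto simp: \<rho>_def A_def)
    qed
    then have \<rho>: "\<rho> \<in> later_times S'"
      using \<rho>_pred by (simp add: later_times_def)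
    have "AE \<omega> in M. \<omega> \<in> A \<longrightarrow>
        nn_cond_exp M (pre S) (\<phi> \<theta>) \<omega> = nn_cond_exp M (pre S') (\<phi> \<rho>) \<omega>"
    proof (rule nn_cond_exp_local[OF finite_measure_axioms subalgebra_pre[OF S] subalgebra_pre[OF S'] A A'])
      show "A \<inter> B \<in> sets (pre S')" if "B \<in> sets (pre S)" for B
        unfolding A_sym by (rule pre_trace_eq[OF S' S that])
      show "A \<inter> B \<in> sets (pre S)" if "B \<in> sets (pre S')" for B
        unfolding A_def by (rule pre_trace_eq[OF S S' that])
      show "AE \<omega> in M. \<omega> \<in> A \<longrightarrow> \<phi> \<theta> \<omega> = \<phi> \<rho> \<omega>"
        using phi_eq[OF \<theta>_pred \<rho>_pred] by eventually_elim (auto simp: \<rho>_def)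
    qed (use \<theta>_pred \<rho>_pred in auto)
    then show "AE \<omega> in M. nn_cond_exp M (pre S) (\<phi> \<theta>) \<omega> \<le> (if \<omega> \<in> A then val S' \<omega> else top)"
      using val_upper[OF S' \<rho>] by eventually_elim auto
  qed measurable
  with AE_space show ?thesis
    by eventually_elim (auto simp: A_def split: if_splits)
qed

lemma val_eq:
  assumes "S \<in> pred_times M F T" "S' \<in> pred_times M F T"
  shows "AE \<omega> in M. S \<omega> = S' \<omega> \<longrightarrow> val S \<omega> = val S' \<omega>"
  using val_le_on_eq[OF assms] val_le_on_eq[OF assms(2,1)]
  by eventually_elim (simp add: order_eq_iff)

text \<open>
  Along a maximising sequence for \<open>S'\<close>, monotone convergence and the tower property turn the
  conditional expectation of the value at \<open>S'\<close> into a supremum of rewards of times that are also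
  allowed from \<open>S\<close>.
\<close>

lemma val_supermartingale:
  assumes S: "S \<in> pred_times M F T" and S': "S' \<in> pred_times M F T"
    and le: "AE \<omega> in M. S \<omega> \<le> S' \<omega>"
  shows "AE \<omega> in M. nn_cond_exp M (pre S) (val S') \<omega> \<le> val S \<omega>"
proof -
  interpret S: finite_measure_subalgebra M "pre S"
    by unfold_locales (rule subalgebra_pre[OF S])
  obtain \<theta> :: "nat \<Rightarrow> 'a \<Rightarrow> real" where \<theta>: "\<And>n. \<theta> n \<in> later_times S'"
    "\<And>n. AE \<omega> in M. nn_cond_exp M (pre S') (\<phi> (\<theta> n)) \<omega> \<le> nn_cond_exp M (pre S') (\<phi> (\<theta> (Suc n))) \<omega>"
    "AE \<omega> in M. val S' \<omega> = (SUP n. nn_cond_exp M (pre S') (\<phi> (\<theta> n)) \<omega>)"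
    by (rule val_maximizing_sequence[OF S']) (rule that)
  define X where "X = (\<lambda>n. nn_cond_exp M (pre S') (\<phi> (\<theta> n)))"
  have [measurable]: "X n \<in> borel_measurable M" for n
    by (simp add: X_def)
  have [measurable]: "val S' \<in> borel_measurable M"
    by (rule measurable_from_subalg[OF subalgebra_pre val_measurable_pre]; fact)
  have sub: "subalgebra (pre S') (pre S)"
    using pre_mono[OF S S' le] by (simp add: subalgebra_def)
  have "AE \<omega> in M. nn_cond_exp M (pre S) (X n) \<omega> \<le> val S \<omega>" for n
  proof -
    have "AE \<omega> in M. nn_cond_exp M (pre S) (\<phi> (\<theta> n)) \<omega> = nn_cond_exp M (pre S) (X n) \<omega>"
      unfolding X_def using \<theta>(1) later_times_pred
      by (intro S.nn_cond_exp_nested_subalg subalgebra_pre[OF S'] sub phi_measurable) auto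
    moreover have "AE \<omega> in M. nn_cond_exp M (pre S) (\<phi> (\<theta> n)) \<omega> \<le> val S \<omega>"
      using later_times_antimono[OF S S' le] \<theta>(1) by (intro val_upper[OF S]) auto
    ultimately show ?thesis
      by eventually_elim simp
  qed
  then have "AE \<omega> in M. \<forall>n. nn_cond_exp M (pre S) (X n) \<omega> \<le> val S \<omega>"
    by (simp add: AE_all_countable)
  moreover have "AE \<omega> in M. (SUP n. nn_cond_exp M (pre S) (X n) \<omega>)
      = nn_cond_exp M (pre S) (\<lambda>\<omega>. SUP n. X n \<omega>) \<omega>"
    using \<theta>(2) by (intro S.nn_cond_exp_SUP) (auto simp: X_def)
  moreover have "AE \<omega> in M. nn_cond_exp M (pre S) (val S') \<omega>
      = nn_cond_exp M (pre S) (\<lambda>\<omega>. SUP n. X n \<omega>) \<omega>"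
    using \<theta>(3) by (intro S.nn_cond_exp_cong) (auto simp: X_def)
  ultimately show ?thesis
  proof eventually_elim
    case (elim \<omega>)
    then have "nn_cond_exp M (pre S) (val S') \<omega> = (SUP n. nn_cond_exp M (pre S) (X n) \<omega>)"
      by simp
    also have "\<dots> \<le> val S \<omega>"
      using elim by (intro SUP_least) auto
    finally show ?case .
  qed
qed

lemma val_system:
  assumes "I \<subseteq> pred_times M F T"
  shows "pred_supermartingale_system M F T I val"
  unfolding pred_supermartingale_system_def admissible_family_def
  using assms val_measurable_pre val_eq val_supermartingale by blast

lemma val_le_supermartingale:
  assumes V': "pred_supermartingale_system M F T (pred_times M F T) V'"
    and ge: "\<And>\<tau>. \<tau> \<in> pred_times M F T \<Longrightarrow> AE \<omega> in M. \<phi> \<tau> \<omega> \<le> V' \<tau> \<omega>"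
    and S: "S \<in> pred_times M F T"
  shows "AE \<omega> in M. val S \<omega> \<le> V' S \<omega>"
proof -
  interpret S: finite_measure_subalgebra M "pre S"
    by unfold_locales (rule subalgebra_pre[OF S])
  have meas: "V' \<tau> \<in> borel_measurable M" if "\<tau> \<in> pred_times M F T" for \<tau>
    using V' that measurable_from_subalg[OF subalgebra_pre[OF that]]
    by (auto simp: pred_supermartingale_system_def admissible_family_def)
  show ?thesis
  proof (rule val_least[OF S meas[OF S]])
    fix \<theta> assume \<theta>: "\<theta> \<in> later_times S"
    note \<theta>_pred = later_times_pred[OF \<theta>]
    have "AE \<omega> in M. nn_cond_exp M (pre S) (\<phi> \<theta>) \<omega> \<le> nn_cond_exp M (pre S) (V' \<theta>) \<omega>"
      using \<theta>_pred by (intro S.nn_cond_exp_mono ge meas phi_measurable)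
    moreover have "AE \<omega> in M. nn_cond_exp M (pre S) (V' \<theta>) \<omega> \<le> V' S \<omega>"
      using V' S \<theta>_pred later_times_ge[OF S \<theta>] by (auto simp: pred_supermartingale_system_def)
    ultimately show "AE \<omega> in M. nn_cond_exp M (pre S) (\<phi> \<theta>) \<omega> \<le> V' S \<omega>"
      by eventually_elim (rule order_trans)
  qed
qed

lemma phi_le_val:
  assumes S: "S \<in> pred_times M F T" and now: "\<And>s. R s s"
  shows "AE \<omega> in M. \<phi> S \<omega> \<le> val S \<omega>"
proof -
  interpret S: finite_measure_subalgebra M "pre S"
    by unfold_locales (rule subalgebra_pre[OF S])
  have "S \<in> later_times S"
    using S now by (simp add: later_times_def)
  from val_upper[OF S this] S.nn_cond_exp_F_meas[OF phi_measurable_pre[OF S]] show ?thesis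
    by eventually_elim simp
qed

end

theorem mainTheorem2:
  fixes M :: "'a measure" and F :: "real \<Rightarrow> 'a measure" and T :: real
    and \<phi> :: "('a \<Rightarrow> real) \<Rightarrow> 'a \<Rightarrow> ennreal"
  assumes "predictable_setup M F T"
    and "admissible_family M F T (pred_times M F T) \<phi>"
  shows "pred_supermartingale_system M F T (pred_times M F T) (value_family M F T \<phi>) \<and>
         pred_supermartingale_system M F T (pred_times_after M F T (\<lambda>_. 0))
           (strict_value_family M F T \<phi>) \<and>
         is_pred_snell_envelope M F T \<phi> (value_family M F T \<phi>)"
proof -
  interpret predictable_setup M F T by fact
  interpret weak: predictable_stopping M F T \<phi> "(\<le>)"
    by unfold_locales (use assms(2) in auto)
  interpret strict: predictable_stopping M F T \<phi> "\<lambda>s t. (s < T \<longrightarrow> s < t) \<and> (s = T \<longrightarrow> t = T)"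
    by unfold_locales (use assms(2) in \<open>auto simp: less_eq_real_def\<close>)
  have weak: "value_family M F T \<phi> = weak.val"
    by (simp add: fun_eq_iff value_family_def weak.val_def weak.rewards_def weak.later_times_def
        pred_times_from_def)
  have strict: "strict_value_family M F T \<phi> = strict.val"
    by (simp add: fun_eq_iff strict_value_family_def strict.val_def strict.rewards_def
        strict.later_times_def pred_times_after_def)
  have "pred_supermartingale_system M F T (pred_times M F T) weak.val"
    by (rule weak.val_system) simp
  moreover have "pred_supermartingale_system M F T (pred_times_after M F T (\<lambda>_. 0)) strict.val"
    by (rule strict.val_system) (auto simp: pred_times_after_def)
  moreover have "is_pred_snell_envelope M F T \<phi> weak.val"
    unfolding is_pred_snell_envelope_def
    using calculation(1) weak.phi_le_val weak.val_le_supermartingale by blast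
  ultimately show ?thesis
    unfolding weak strict by blast
qed

end
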